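(* Let $(X,d)$ and $(Y,\rho)$ be semimetric spaces, let $f\colon X\to Y$ be a bijection, and let $X$ and $Y$ be weakly similar with the realization $(\varphi,f)$. If there exists a continuous, submultiplicative, strictly increasing continuation (extension) $\varphi^*\colon[0,\infty)\to[0,\infty)$ of the function $\varphi$, then $f$ is an $\eta$-quasisymmetric mapping with $\eta(t)=\varphi^*(t)$.
   Context: A semimetric on a nonempty set $X$ is a function $d\colon X\times X\to[0,\infty)$ with $d(x,y)=0\Leftrightarrow x=y$ and $d(x,y)=d(y,x)$; then $(X,d)$ is a semimetric space. The spectrum of $(X,d)$ is $\operatorname{Sp}(X)=\{d(x,y):x,y\in X\}$. A bijective mapping $f\colon X\to Y$ between semimetric spaces $(X,d)$, $(Y,\rho)$ is a weak similarity if there is a strictly increasing bijection $\varphi\colon\operatorname{Sp}(X)\to\operatorname{Sp}(Y)$ (a scaling function of $f$) such that $\varphi(d(x,y))=\rho(f(x),f(y))$ for all $x,y\in X$; in this case $X$ and $Y$ are weakly similar and $(\varphi,f)$ is called a realization of the weak similarity. A function $\psi\colon[0,\infty)\to[0,\infty)$ is submultiplicative if $\psi(uv)\leqslant\psi(u)\psi(v)$ for all $u,v\geqslant 0$. For a homeomorphism $\eta\colon[0,\infty)\to[0,\infty)$, a mapping $f\colon X\to Y$ is $\eta$-quasisymmetric if $d(x,a)\leqslant t\,d(x,b)$ implies $\rho(f(x),f(a))\leqslant\eta(t)\rho(f(x),f(b))$ for all $a,b,x\in X$ and all $t>0$. *)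

theory Defs
  imports "HOL-Analysis.Analysis"
begin

text \<open>
  Spaces are given by an explicit carrier and a distance function of which only the values on
  the carrier matter. The half-line of nonnegative reals is rendered as \<open>{0..} :: real set\<close>;
  a function between half-lines is a total function on the reals of which only the values on
  \<open>{0..}\<close> matter.
\<close>

definition semimetric_space :: "'a set \<Rightarrow> ('a \<Rightarrow> 'a \<Rightarrow> real) \<Rightarrow> bool" where
  "semimetric_space X d \<longleftrightarrow>
     X \<noteq> {} \<and>
     (\<forall>x\<in>X. \<forall>y\<in>X. 0 \<le> d x y) \<and>
     (\<forall>x\<in>X. \<forall>y\<in>X. d x y = 0 \<longleftrightarrow> x = y) \<and>
     (\<forall>x\<in>X. \<forall>y\<in>X. d x y = d y x)"

definition spectrum :: "'a set \<Rightarrow> ('a \<Rightarrow> 'a \<Rightarrow> real) \<Rightarrow> real set" where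
  "spectrum X d = {d x y | x y. x \<in> X \<and> y \<in> X}"

definition scaling_function ::
    "'a set \<Rightarrow> ('a \<Rightarrow> 'a \<Rightarrow> real) \<Rightarrow> 'b set \<Rightarrow> ('b \<Rightarrow> 'b \<Rightarrow> real) \<Rightarrow>
     ('a \<Rightarrow> 'b) \<Rightarrow> (real \<Rightarrow> real) \<Rightarrow> bool" where
  "scaling_function X d Y \<rho> f \<phi> \<longleftrightarrow>
     bij_betw \<phi> (spectrum X d) (spectrum Y \<rho>) \<and>
     strict_mono_on (spectrum X d) \<phi> \<and>
     (\<forall>x\<in>X. \<forall>y\<in>X. \<phi> (d x y) = \<rho> (f x) (f y))"

definition weak_similarity_realization ::
    "'a set \<Rightarrow> ('a \<Rightarrow> 'a \<Rightarrow> real) \<Rightarrow> 'b set \<Rightarrow> ('b \<Rightarrow> 'b \<Rightarrow> real) \<Rightarrow>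
     (real \<Rightarrow> real) \<Rightarrow> ('a \<Rightarrow> 'b) \<Rightarrow> bool" where
  "weak_similarity_realization X d Y \<rho> \<phi> f \<longleftrightarrow>
     bij_betw f X Y \<and> scaling_function X d Y \<rho> f \<phi>"

definition submultiplicative :: "(real \<Rightarrow> real) \<Rightarrow> bool" where
  "submultiplicative \<psi> \<longleftrightarrow> (\<forall>u\<ge>0. \<forall>v\<ge>0. \<psi> (u * v) \<le> \<psi> u * \<psi> v)"

text \<open>
  The control function \<open>\<eta>\<close> is required to be a self-homeomorphism of the half-line, so
  this is part of what an assertion of quasisymmetry claims.
\<close>

definition quasisymmetric ::
    "(real \<Rightarrow> real) \<Rightarrow> 'a set \<Rightarrow> ('a \<Rightarrow> 'a \<Rightarrow> real) \<Rightarrow> 'b set \<Rightarrow> ('b \<Rightarrow> 'b \<Rightarrow> real) \<Rightarrow>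
     ('a \<Rightarrow> 'b) \<Rightarrow> bool" where
  "quasisymmetric \<eta> X d Y \<rho> f \<longleftrightarrow>
     (\<exists>\<theta>. homeomorphism {0..} {0..} \<eta> \<theta>) \<and>
     f \<in> X \<rightarrow> Y \<and>
     (\<forall>a\<in>X. \<forall>b\<in>X. \<forall>x\<in>X. \<forall>t>0.
        d x a \<le> t * d x b \<longrightarrow> \<rho> (f x) (f a) \<le> \<eta> t * \<rho> (f x) (f b))"

end

theory Submission
  imports Defs
begin

text \<open>
  The inequality follows from applying the monotone submultiplicative extension to
  \<open>d x a \<le> t * d x b\<close>. That the extension maps the half-line onto itself comes
  from \<open>\<psi> 1 \<le> \<psi> t * \<psi> (1 / t)\<close>: as \<open>t\<close> tends to \<open>0\<close>, so does
  \<open>\<psi> t\<close>, hence \<open>\<psi> (1 / t)\<close> is unbounded.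
\<close>

lemma submultiplicative_surj_halfline:
  fixes \<psi> :: "real \<Rightarrow> real"
  assumes "\<psi> \<in> {0..} \<rightarrow> {0..}" and cont: "continuous_on {0..} \<psi>"
    and sub: "submultiplicative \<psi>" and mono: "strict_mono_on {0..} \<psi>" and zero: "\<psi> 0 = 0"
  shows "\<psi> ` {0..} = {0..}"
proof
  show "\<psi> ` {0..} \<subseteq> {0..}"
    using assms(1) by auto
  show "{0..} \<subseteq> \<psi> ` {0..}"
  proof
    fix y :: real
    assume "y \<in> {0..}"
    then have y: "0 \<le> y" by simp
    have pos: "0 < \<psi> t" if "0 < t" for t
      using strict_mono_onD[OF mono, of 0 t] that zero by simp
    \<comment> \<open>This bound makes \<open>\<psi> t < e\<close> equivalent to
      \<open>\<psi> t * (y + 1) < \<psi> 1\<close>; taking \<open>y + 1\<close> instead of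
      \<open>y\<close> keeps the denominator positive when \<open>y = 0\<close>.\<close>
    define e where "e = \<psi> 1 / (y + 1)"
    have "0 < e"
      using pos[of 1] y by (simp add: e_def)
    then obtain r where r: "0 < r" and close: "\<And>t. 0 \<le> t \<Longrightarrow> \<bar>t\<bar> < r \<Longrightarrow> \<bar>\<psi> t\<bar> < e"
      using cont zero unfolding continuous_on_iff by (force simp: dist_real_def)
    define t where "t = r / 2"
    have t: "0 < t" "\<psi> t < e"
      using r close[of t] by (auto simp: t_def)
    have "\<psi> t * (y + 1) < \<psi> 1"
      using t(2) y by (simp add: e_def pos_less_divide_eq)
    also have "\<psi> 1 \<le> \<psi> t * \<psi> (1 / t)"
      using sub[unfolded submultiplicative_def, rule_format, of t "1 / t"] t(1) by simp
    finally have "y + 1 < \<psi> (1 / t)"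
      using pos[OF t(1)] by simp
    then have "y \<le> \<psi> (1 / t)" by simp
    \<comment> \<open>The value \<open>y\<close> lies between \<open>\<psi> 0 = 0\<close> and
      \<open>\<psi> (1 / t)\<close>, so the intermediate value theorem applies.\<close>
    moreover have "continuous_on {0..1 / t} \<psi>"
      using cont by (rule continuous_on_subset) auto
    ultimately obtain x where "0 \<le> x" "\<psi> x = y"
      using IVT'[of \<psi> 0 y "1 / t"] zero y t(1) by auto
    then show "y \<in> \<psi> ` {0..}" by auto
  qed
qed

theorem proposition5p3:
  fixes X :: "'a set" and d :: "'a \<Rightarrow> 'a \<Rightarrow> real"
    and Y :: "'b set" and \<rho> :: "'b \<Rightarrow> 'b \<Rightarrow> real"
    and f :: "'a \<Rightarrow> 'b" and \<phi> \<phi>' :: "real \<Rightarrow> real"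
  assumes "semimetric_space X d"
    and "semimetric_space Y \<rho>"
    and "bij_betw f X Y"
    and "weak_similarity_realization X d Y \<rho> \<phi> f"
    and "\<phi>' \<in> {0..} \<rightarrow> {0..}"
    and "continuous_on {0..} \<phi>'"
    and "submultiplicative \<phi>'"
    and "strict_mono_on {0..} \<phi>'"
    and "\<forall>s\<in>spectrum X d. \<phi>' s = \<phi> s"
  shows "quasisymmetric \<phi>' X d Y \<rho> f"
proof -
  from assms(1) obtain x\<^sub>0 where x0: "x\<^sub>0 \<in> X" "d x\<^sub>0 x\<^sub>0 = 0"
    unfolding semimetric_space_def by blast
  have f: "f \<in> X \<rightarrow> Y"
    using assms(3) by (auto simp: bij_betw_def)
  have ext: "\<phi>' (d x y) = \<rho> (f x) (f y)" if "x \<in> X" "y \<in> X" for x y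
  proof -
    have "d x y \<in> spectrum X d"
      using that by (auto simp: spectrum_def)
    then show ?thesis
      using assms(4,9) that
      by (simp add: weak_similarity_realization_def scaling_function_def)
  qed
  \<comment> \<open>Submultiplicativity alone does not give this: u + 1 is submultiplicative on the
    half-line. The value is forced because 0 is in the spectrum and \<open>\<rho>\<close> vanishes
    on the diagonal.\<close>
  have "\<phi>' 0 = 0"
    using ext[OF x0(1) x0(1)] x0 funcset_mem[OF f x0(1)] assms(2)
    by (simp add: semimetric_space_def)
  then have surj: "\<phi>' ` {0..} = {0..}"
    by (rule submultiplicative_surj_halfline[OF assms(5-8)])
  \<comment> \<open>A continuous injection on an interval has a continuous inverse on its image,
    here the whole half-line.\<close>
  have "\<exists>\<theta>. homeomorphism {0..} {0..} \<phi>' \<theta>"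
    using homeomorphism_into_1d[OF _ assms(6) surj strict_mono_on_imp_inj_on[OF assms(8)]]
    by (meson convex_imp_path_connected convex_real_interval(1))
  moreover have "\<rho> (f x) (f a) \<le> \<phi>' t * \<rho> (f x) (f b)"
    if X: "a \<in> X" "b \<in> X" "x \<in> X" and t: "0 < t" "d x a \<le> t * d x b" for a b x t
  proof -
    have nonneg: "0 \<le> d x a" "0 \<le> d x b"
      using assms(1) X by (auto simp: semimetric_space_def)
    \<comment> \<open>The product \<open>t * d x b\<close> may lie outside the spectrum, so the
      estimate must pass through the extension.\<close>
    have "\<phi>' (d x a) \<le> \<phi>' (t * d x b)"
      using strict_mono_on_leD[OF assms(8), of "d x a" "t * d x b"] nonneg t by simp
    also have "\<dots> \<le> \<phi>' t * \<phi>' (d x b)"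
      using assms(7) nonneg t by (simp add: submultiplicative_def)
    finally show ?thesis
      using ext X by simp
  qed
  ultimately show ?thesis
    using f by (simp add: quasisymmetric_def)
qed

end
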